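(* Let $n\in\mathbb{Z}_{\ge0}$ and let $\lambda,\mu,\nu$ be partitions such that $\lambda_{[n]},\mu_{[n]},\nu_{[n]}$ are partitions of $n$. Then the Kronecker coefficients satisfy $$g_{\lambda_{[n]},\mu_{[n]}}^{\nu_{[n]}}\le g_{\lambda_{[n+1]},\mu_{[n+1]}}^{\nu_{[n+1]}}.$$
   Context: For a partition $\lambda=(\lambda_1,\lambda_2,\dots)$ and $n\ge0$, $\lambda_{[n]}=(n-|\lambda|,\lambda_1,\lambda_2,\dots)$; this is a partition of $n$ exactly when $n-|\lambda|\ge\lambda_1$ (and then $\lambda_{[n+1]}$ is a partition of $n+1$). For a partition $\alpha$ of $n$, $\mathbf{S}(\alpha)$ is the Specht module, i.e. the simple $\mathbb{Q}\mathfrak{S}_n$-module labelled by $\alpha$. For partitions $\alpha,\beta,\gamma$ of $n$ the Kronecker coefficient is $g_{\alpha,\beta}^{\gamma}=\dim_{\mathbb{Q}}\mathrm{Hom}_{\mathbb{Q}\mathfrak{S}_n}(\mathbf{S}(\alpha)\otimes\mathbf{S}(\beta),\mathbf{S}(\gamma))$, where $\mathfrak S_n$ acts diagonally on the tensor product. *)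

theory Defs
  imports Complex_Main "HOL-Library.Function_Algebras" "HOL-Combinatorics.Permutations"
begin

text \<open>A partition is a weakly decreasing sequence of natural numbers with finitely many nonzero
  terms; the parts are indexed from \<open>0\<close>, so that \<open>\<lambda>\<^sub>1\<close> is \<open>\<alpha> 0\<close>.\<close>

definition is_partition :: "(nat \<Rightarrow> nat) \<Rightarrow> bool" where
  "is_partition \<alpha> \<longleftrightarrow> antimono \<alpha> \<and> finite {i. \<alpha> i \<noteq> 0}"

definition psize :: "(nat \<Rightarrow> nat) \<Rightarrow> nat" where
  "psize \<alpha> = (\<Sum>i | \<alpha> i \<noteq> 0. \<alpha> i)"

definition partition_of :: "nat \<Rightarrow> (nat \<Rightarrow> nat) \<Rightarrow> bool" where
  "partition_of n \<alpha> \<longleftrightarrow> is_partition \<alpha> \<and> psize \<alpha> = n"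

text \<open>\<open>padded n \<alpha>\<close> is $\alpha_{[n]}$. The subtraction is truncated, but this creates no spurious
  partitions: if \<open>n < psize \<alpha>\<close>, the first entry is \<open>0\<close> and some later entry is positive.\<close>

definition padded :: "nat \<Rightarrow> (nat \<Rightarrow> nat) \<Rightarrow> nat \<Rightarrow> nat" where
  "padded n \<alpha> i = (case i of 0 \<Rightarrow> n - psize \<alpha> | Suc j \<Rightarrow> \<alpha> j)"

lemma partition_of_padded_iff:
  assumes "is_partition \<alpha>"
  shows "partition_of n (padded n \<alpha>) \<longleftrightarrow> psize \<alpha> + \<alpha> 0 \<le> n"
proof -
  have fin: "finite {i. \<alpha> i \<noteq> 0}" and anti: "antimono \<alpha>"
    using assms by (auto simp: is_partition_def)
  have zero: "\<alpha> i = 0" if "\<alpha> 0 = 0" for i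
    using antimonoD[OF anti, of 0 i] that by simp
  have supp: "{i. padded n \<alpha> i \<noteq> 0} \<subseteq> insert 0 (Suc ` {i. \<alpha> i \<noteq> 0})"
  proof
    fix i assume "i \<in> {i. padded n \<alpha> i \<noteq> 0}"
    then show "i \<in> insert 0 (Suc ` {i. \<alpha> i \<noteq> 0})"
      by (cases i) (auto simp: padded_def)
  qed
  have finp: "finite {i. padded n \<alpha> i \<noteq> 0}"
    by (rule finite_subset[OF supp]) (use fin in simp)
  have "psize (padded n \<alpha>) = (\<Sum>i\<in>insert 0 (Suc ` {i. \<alpha> i \<noteq> 0}). padded n \<alpha> i)"
    unfolding psize_def by (rule sum.mono_neutral_left) (use fin supp in auto)
  also have "\<dots> = n - psize \<alpha> + (\<Sum>i\<in>Suc ` {i. \<alpha> i \<noteq> 0}. padded n \<alpha> i)"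
    using fin by (subst sum.insert) (auto simp: padded_def)
  also have "(\<Sum>i\<in>Suc ` {i. \<alpha> i \<noteq> 0}. padded n \<alpha> i) = psize \<alpha>"
    by (simp add: sum.reindex psize_def padded_def)
  finally have size: "psize (padded n \<alpha>) = n - psize \<alpha> + psize \<alpha>" .
  have "antimono (padded n \<alpha>) \<longleftrightarrow> \<alpha> 0 \<le> n - psize \<alpha>"
  proof
    assume "antimono (padded n \<alpha>)"
    from antimonoD[OF this, of 0 1] show "\<alpha> 0 \<le> n - psize \<alpha>" by (simp add: padded_def)
  next
    assume le: "\<alpha> 0 \<le> n - psize \<alpha>"
    show "antimono (padded n \<alpha>)"
    proof (rule antimonoI)
      fix i j :: nat assume "i \<le> j"
      then show "padded n \<alpha> j \<le> padded n \<alpha> i"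
        using le antimonoD[OF anti, of 0] antimonoD[OF anti, of "i - 1" "j - 1"]
        by (cases i; cases j) (auto simp: padded_def intro: order_trans)
    qed
  qed
  then have "partition_of n (padded n \<alpha>) \<longleftrightarrow> \<alpha> 0 \<le> n - psize \<alpha> \<and> psize \<alpha> \<le> n"
    using finp size by (auto simp: partition_of_def is_partition_def)
  moreover have "psize \<alpha> = 0" if "\<alpha> 0 = 0"
    using zero[OF that] by (simp add: psize_def)
  ultimately show ?thesis by auto
qed

text \<open>Pointwise scalar multiplication by rationals, on functions \<open>'x \<Rightarrow> rat\<close> and on maps between
  spaces of such functions.\<close>

definition scale_fun :: "rat \<Rightarrow> ('x \<Rightarrow> rat) \<Rightarrow> 'x \<Rightarrow> rat" where
  "scale_fun c v = (\<lambda>x. c * v x)"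

definition scale_map :: "rat \<Rightarrow> ('v \<Rightarrow> 'y \<Rightarrow> rat) \<Rightarrow> 'v \<Rightarrow> 'y \<Rightarrow> rat" where
  "scale_map c f = (\<lambda>v. scale_fun c (f v))"

interpretation fun_space: vector_space "scale_fun :: rat \<Rightarrow> ('x \<Rightarrow> rat) \<Rightarrow> 'x \<Rightarrow> rat"
  by unfold_locales (auto simp: scale_fun_def fun_eq_iff algebra_simps)

interpretation map_space: vector_space
    "scale_map :: rat \<Rightarrow> ('v \<Rightarrow> 'y \<Rightarrow> rat) \<Rightarrow> 'v \<Rightarrow> 'y \<Rightarrow> rat"
  by unfold_locales (auto simp: scale_map_def scale_fun_def fun_eq_iff algebra_simps)

text \<open>Young diagrams in English notation; the symmetric group of degree \<open>n\<close> is
  \<open>{\<sigma>. \<sigma> permutes {1..n}}\<close>. The values of a tableau outside the diagram are irrelevant.\<close>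

definition diagram :: "(nat \<Rightarrow> nat) \<Rightarrow> (nat \<times> nat) set" where
  "diagram \<alpha> = {(i, j). j < \<alpha> i}"

definition is_tableau :: "nat \<Rightarrow> (nat \<Rightarrow> nat) \<Rightarrow> (nat \<times> nat \<Rightarrow> nat) \<Rightarrow> bool" where
  "is_tableau n \<alpha> t \<longleftrightarrow> bij_betw t (diagram \<alpha>) {1..n}"

text \<open>The tabloid of \<open>t\<close> (its class modulo row equivalence) is encoded as the sequence of the
  sets of entries of the rows of \<open>t\<close>.\<close>

definition tabloid :: "(nat \<Rightarrow> nat) \<Rightarrow> (nat \<times> nat \<Rightarrow> nat) \<Rightarrow> nat \<Rightarrow> nat set" where
  "tabloid \<alpha> t = (\<lambda>i. {t (i, j) | j. (i, j) \<in> diagram \<alpha>})"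

definition act_tabloid :: "(nat \<Rightarrow> nat) \<Rightarrow> (nat \<Rightarrow> nat set) \<Rightarrow> nat \<Rightarrow> nat set" where
  "act_tabloid \<sigma> T = (\<lambda>i. \<sigma> ` T i)"

definition column :: "(nat \<Rightarrow> nat) \<Rightarrow> (nat \<times> nat \<Rightarrow> nat) \<Rightarrow> nat \<Rightarrow> nat set" where
  "column \<alpha> t j = {t (i, j) | i. (i, j) \<in> diagram \<alpha>}"

definition column_stabilizer ::
    "nat \<Rightarrow> (nat \<Rightarrow> nat) \<Rightarrow> (nat \<times> nat \<Rightarrow> nat) \<Rightarrow> (nat \<Rightarrow> nat) set" where
  "column_stabilizer n \<alpha> t =
    {\<sigma>. \<sigma> permutes {1..n} \<and> (\<forall>j. \<sigma> ` column \<alpha> t j = column \<alpha> t j)}"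

text \<open>A formal rational combination of tabloids is a function from tabloids to \<open>rat\<close>, the
  coefficient function. The polytabloid of \<open>t\<close> is the sum of
  \<open>sign \<sigma>\<close> times the tabloid \<open>\<sigma>{t}\<close> over the column stabilizer, and the Specht module is the span
  of all polytabloids (so the partition with one part \<open>n\<close> labels the trivial module).\<close>

definition polytabloid ::
    "nat \<Rightarrow> (nat \<Rightarrow> nat) \<Rightarrow> (nat \<times> nat \<Rightarrow> nat) \<Rightarrow> (nat \<Rightarrow> nat set) \<Rightarrow> rat" where
  "polytabloid n \<alpha> t = (\<lambda>T. \<Sum>\<sigma>\<in>column_stabilizer n \<alpha> t.
     of_int (sign \<sigma>) * of_bool (T = act_tabloid \<sigma> (tabloid \<alpha> t)))"

definition specht :: "nat \<Rightarrow> (nat \<Rightarrow> nat) \<Rightarrow> ((nat \<Rightarrow> nat set) \<Rightarrow> rat) set" where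
  "specht n \<alpha> = fun_space.span {polytabloid n \<alpha> t | t. is_tableau n \<alpha> t}"

text \<open>The linear action on coefficient functions with \<open>\<sigma> \<cdot> \<delta>\<^sub>T = \<delta>\<^bsub>\<sigma> T\<^esub>\<close>.\<close>

definition act :: "(nat \<Rightarrow> nat) \<Rightarrow> ((nat \<Rightarrow> nat set) \<Rightarrow> rat) \<Rightarrow> (nat \<Rightarrow> nat set) \<Rightarrow> rat" where
  "act \<sigma> v = (\<lambda>T. v (act_tabloid (inv \<sigma>) T))"

lemma act_specht:
  assumes \<sigma>: "\<sigma> permutes {1..n}" and v: "v \<in> specht n \<alpha>"
  shows "act \<sigma> v \<in> specht n \<alpha>"
proof -
  let ?P = "{polytabloid n \<alpha> t | t. is_tableau n \<alpha> t}"
  have lin: "module_hom scale_fun scale_fun (act \<sigma>)"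
    by unfold_locales (auto simp: act_def scale_fun_def fun_eq_iff algebra_simps)
  have bij: "bij \<sigma>" using \<sigma> by (rule permutes_bij)
  have poly: "act \<sigma> (polytabloid n \<alpha> t) = polytabloid n \<alpha> (\<sigma> \<circ> t)" for t
  proof
    fix T
    have col: "column \<alpha> (\<sigma> \<circ> t) j = \<sigma> ` column \<alpha> t j" for j
      by (auto simp: column_def)
    have tab: "tabloid \<alpha> (\<sigma> \<circ> t) = act_tabloid \<sigma> (tabloid \<alpha> t)"
      by (auto simp: tabloid_def act_tabloid_def)
    have inv: "inv \<sigma> (\<sigma> x) = x" "\<sigma> (inv \<sigma> x) = x" for x
      using \<sigma> by (auto simp: permutes_inverses)
    have "polytabloid n \<alpha> (\<sigma> \<circ> t) T = (\<Sum>\<tau>\<in>column_stabilizer n \<alpha> t. of_int (sign \<tau>) *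
        of_bool (act_tabloid (inv \<sigma>) T = act_tabloid \<tau> (tabloid \<alpha> t)))"
      unfolding polytabloid_def
    proof (rule sum.reindex_bij_witness[where i = "\<lambda>\<tau>. \<sigma> \<circ> \<tau> \<circ> inv \<sigma>" and j = "\<lambda>\<tau>. inv \<sigma> \<circ> \<tau> \<circ> \<sigma>"])
      fix \<tau> assume \<tau>: "\<tau> \<in> column_stabilizer n \<alpha> (\<sigma> \<circ> t)"
      show "\<sigma> \<circ> (inv \<sigma> \<circ> \<tau> \<circ> \<sigma>) \<circ> inv \<sigma> = \<tau>" by (auto simp: inv)
      have p: "\<tau> permutes {1..n}" using \<tau> by (simp add: column_stabilizer_def)
      have "(inv \<sigma> \<circ> \<tau> \<circ> \<sigma>) permutes {1..n}"
        using \<sigma> p by (intro permutes_compose permutes_inv) auto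
      moreover have "(inv \<sigma> \<circ> \<tau> \<circ> \<sigma>) ` column \<alpha> t j = column \<alpha> t j" for j
      proof -
        have "\<tau> ` \<sigma> ` column \<alpha> t j = \<sigma> ` column \<alpha> t j"
          using \<tau> by (simp add: column_stabilizer_def col)
        then have "inv \<sigma> ` \<tau> ` \<sigma> ` column \<alpha> t j = inv \<sigma> ` \<sigma> ` column \<alpha> t j" by simp
        then show ?thesis by (simp add: image_image inv)
      qed
      ultimately show "inv \<sigma> \<circ> \<tau> \<circ> \<sigma> \<in> column_stabilizer n \<alpha> t"
        by (simp add: column_stabilizer_def)
      have perm: "permutation \<sigma>" "permutation \<tau>" "permutation (inv \<sigma>)"
        using \<sigma> p permutes_inv[OF \<sigma>] by (auto intro: permutation_permutes[THEN iffD2])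
      have "sign (inv \<sigma> \<circ> \<tau> \<circ> \<sigma>) = sign \<tau>"
        using perm sign_idempotent[of \<sigma>]
        by (simp add: sign_compose permutation_compose sign_inverse mult.commute mult.left_commute)
      moreover have "act_tabloid (inv \<sigma>) T = act_tabloid (inv \<sigma> \<circ> \<tau> \<circ> \<sigma>) (tabloid \<alpha> t) \<longleftrightarrow>
          T = act_tabloid \<tau> (tabloid \<alpha> (\<sigma> \<circ> t))"
      proof
        assume "act_tabloid (inv \<sigma>) T = act_tabloid (inv \<sigma> \<circ> \<tau> \<circ> \<sigma>) (tabloid \<alpha> t)"
        then have "act_tabloid \<sigma> (act_tabloid (inv \<sigma>) T) =
            act_tabloid \<sigma> (act_tabloid (inv \<sigma> \<circ> \<tau> \<circ> \<sigma>) (tabloid \<alpha> t))" by simp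
        then show "T = act_tabloid \<tau> (tabloid \<alpha> (\<sigma> \<circ> t))"
          by (simp add: act_tabloid_def tab image_image inv)
      next
        assume "T = act_tabloid \<tau> (tabloid \<alpha> (\<sigma> \<circ> t))"
        then show "act_tabloid (inv \<sigma>) T = act_tabloid (inv \<sigma> \<circ> \<tau> \<circ> \<sigma>) (tabloid \<alpha> t)"
          by (simp add: act_tabloid_def tab image_image)
      qed
      ultimately show "of_int (sign (inv \<sigma> \<circ> \<tau> \<circ> \<sigma>)) *
          of_bool (act_tabloid (inv \<sigma>) T = act_tabloid (inv \<sigma> \<circ> \<tau> \<circ> \<sigma>) (tabloid \<alpha> t)) =
          (of_int (sign \<tau>) * of_bool (T = act_tabloid \<tau> (tabloid \<alpha> (\<sigma> \<circ> t))) :: rat)"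
        by simp
    next
      fix \<tau> assume \<tau>: "\<tau> \<in> column_stabilizer n \<alpha> t"
      show "inv \<sigma> \<circ> (\<sigma> \<circ> \<tau> \<circ> inv \<sigma>) \<circ> \<sigma> = \<tau>" by (auto simp: inv)
      have "(\<sigma> \<circ> \<tau> \<circ> inv \<sigma>) permutes {1..n}"
        using \<sigma> \<tau> by (intro permutes_compose permutes_inv) (auto simp: column_stabilizer_def)
      moreover have "(\<sigma> \<circ> \<tau> \<circ> inv \<sigma>) ` \<sigma> ` column \<alpha> t j = \<sigma> ` column \<alpha> t j" for j
      proof -
        have "\<tau> ` column \<alpha> t j = column \<alpha> t j"
          using \<tau> by (simp add: column_stabilizer_def)
        then have "\<sigma> ` \<tau> ` column \<alpha> t j = \<sigma> ` column \<alpha> t j" by simp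
        then show ?thesis by (simp add: image_image inv)
      qed
      ultimately show "\<sigma> \<circ> \<tau> \<circ> inv \<sigma> \<in> column_stabilizer n \<alpha> (\<sigma> \<circ> t)"
        by (simp add: column_stabilizer_def col)
    qed
    then show "act \<sigma> (polytabloid n \<alpha> t) T = polytabloid n \<alpha> (\<sigma> \<circ> t) T"
      by (simp add: act_def polytabloid_def)
  qed
  have "act \<sigma> ` ?P \<subseteq> ?P"
  proof safe
    fix t assume "is_tableau n \<alpha> t"
    then have "is_tableau n \<alpha> (\<sigma> \<circ> t)"
      using permutes_imp_bij[OF \<sigma>] by (auto simp: is_tableau_def intro: bij_betw_trans)
    then show "\<exists>t'. act \<sigma> (polytabloid n \<alpha> t) = polytabloid n \<alpha> t' \<and> is_tableau n \<alpha> t'"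
      using poly by blast
  qed
  then have "fun_space.span (act \<sigma> ` ?P) \<subseteq> specht n \<alpha>"
    unfolding specht_def by (rule fun_space.span_mono)
  moreover have "act \<sigma> v \<in> act \<sigma> ` fun_space.span ?P"
    using v by (simp add: specht_def)
  ultimately show ?thesis
    using module_hom.span_image[OF lin, of ?P] by auto
qed

text \<open>For subspaces \<open>V\<close> of \<open>'x \<Rightarrow> rat\<close> and \<open>W\<close> of \<open>'y \<Rightarrow> rat\<close>, the tensor product over the
  rationals is realized inside \<open>'x \<times> 'y \<Rightarrow> rat\<close> via the canonical injection sending
  \<open>v \<otimes> w\<close> to \<open>(x, y) \<mapsto> v x * w y\<close>.\<close>

definition pure_tensor :: "('x \<Rightarrow> rat) \<Rightarrow> ('y \<Rightarrow> rat) \<Rightarrow> 'x \<times> 'y \<Rightarrow> rat" where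
  "pure_tensor v w = (\<lambda>(x, y). v x * w y)"

definition tensor :: "('x \<Rightarrow> rat) set \<Rightarrow> ('y \<Rightarrow> rat) set \<Rightarrow> ('x \<times> 'y \<Rightarrow> rat) set" where
  "tensor V W = fun_space.span {pure_tensor v w | v w. v \<in> V \<and> w \<in> W}"

definition diag_act :: "(nat \<Rightarrow> nat) \<Rightarrow> ((nat \<Rightarrow> nat set) \<times> (nat \<Rightarrow> nat set) \<Rightarrow> rat) \<Rightarrow>
    (nat \<Rightarrow> nat set) \<times> (nat \<Rightarrow> nat set) \<Rightarrow> rat" where
  "diag_act \<sigma> u = (\<lambda>(S, T). u (act_tabloid (inv \<sigma>) S, act_tabloid (inv \<sigma>) T))"

lemma diag_act_pure_tensor:
  "diag_act \<sigma> (pure_tensor v w) = pure_tensor (act \<sigma> v) (act \<sigma> w)"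
  by (auto simp: diag_act_def pure_tensor_def act_def)

text \<open>The space of \<open>G\<close>-equivariant linear maps from \<open>V\<close> to \<open>W\<close>, where \<open>G\<close> acts by \<open>actV\<close> and
  \<open>actW\<close>. A map defined on \<open>V\<close> is represented by its extension by zero outside \<open>V\<close>, so that each
  map has exactly one representative.\<close>

definition equivariant_maps ::
    "'g set \<Rightarrow> ('g \<Rightarrow> ('x \<Rightarrow> rat) \<Rightarrow> 'x \<Rightarrow> rat) \<Rightarrow> ('g \<Rightarrow> ('y \<Rightarrow> rat) \<Rightarrow> 'y \<Rightarrow> rat) \<Rightarrow>
     ('x \<Rightarrow> rat) set \<Rightarrow> ('y \<Rightarrow> rat) set \<Rightarrow> (('x \<Rightarrow> rat) \<Rightarrow> 'y \<Rightarrow> rat) set" where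
  "equivariant_maps G actV actW V W =
    {f. (\<forall>v\<in>V. f v \<in> W) \<and> (\<forall>v. v \<notin> V \<longrightarrow> f v = 0) \<and>
        (\<forall>u\<in>V. \<forall>v\<in>V. f (u + v) = f u + f v) \<and>
        (\<forall>c. \<forall>v\<in>V. f (scale_fun c v) = scale_fun c (f v)) \<and>
        (\<forall>\<sigma>\<in>G. \<forall>v\<in>V. f (actV \<sigma> v) = actW \<sigma> (f v))}"

lemma subspace_equivariant_maps:
  assumes "fun_space.subspace W"
    and "\<And>\<sigma> w w'. \<sigma> \<in> G \<Longrightarrow> actW \<sigma> (w + w') = actW \<sigma> w + actW \<sigma> w'"
    and "\<And>\<sigma> c w. \<sigma> \<in> G \<Longrightarrow> actW \<sigma> (scale_fun c w) = scale_fun c (actW \<sigma> w)"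
  shows "map_space.subspace (equivariant_maps G actV actW V W)"
proof -
  have zero: "actW \<sigma> 0 = 0" if "\<sigma> \<in> G" for \<sigma>
    using assms(3)[OF that, of 0 0] by simp
  show ?thesis
    unfolding map_space.subspace_def equivariant_maps_def
    using fun_space.subspace_0[OF assms(1)] fun_space.subspace_add[OF assms(1)]
      fun_space.subspace_scale[OF assms(1)] zero
    by (auto simp: assms scale_map_def fun_space.scale_right_distrib mult.commute)
qed

definition kronecker :: "nat \<Rightarrow> (nat \<Rightarrow> nat) \<Rightarrow> (nat \<Rightarrow> nat) \<Rightarrow> (nat \<Rightarrow> nat) \<Rightarrow> nat" where
  "kronecker n \<alpha> \<beta> \<gamma> = map_space.dim
    (equivariant_maps {\<sigma>. \<sigma> permutes {1..n}} diag_act act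
      (tensor (specht n \<alpha>) (specht n \<beta>)) (specht n \<gamma>))"

end

theory Submission imports Defs begin

text \<open>
  Enlarging \<open>n\<close> by one appends a box to the first row of each of the three diagrams. Two facts make
  the Kronecker coefficient grow.

  First, a box at the end of the first row of a diagram forms a column of its own. Hence entering
  the new number \<open>n + 1\<close> there changes neither the column stabilizer of a tableau nor the signs, and
  the injection of tabloids "put \<open>n + 1\<close> into the first row" carries polytabloids to polytabloids.
  Extending coefficient functions by zero along this injection therefore maps each Specht module of
  degree \<open>n\<close> into the corresponding one of degree \<open>n + 1\<close> (\<open>adjoin_specht\<close>).

  Second, an equivariant map \<open>V \<rightarrow> W\<close> between spaces of functions on finite sets \<open>X\<close> and \<open>Z\<close> is the
  same as an invariant kernel \<open>K(x, z)\<close>, i.e. an invariant vector in \<open>V \<otimes> W\<close>, because permutation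
  modules over the rationals carry an invariant positive definite form. For
  \<open>V = S(\<alpha>) \<otimes> S(\<beta>)\<close> and \<open>W = S(\<gamma>)\<close> such a kernel is a function on triples of tabloids. Extend it by
  zero to degree \<open>n + 1\<close> and sum its translates under the larger symmetric group. By the first fact
  the result is again an invariant kernel of the required kind, so this is a linear map between the
  two Hom spaces.

  It is injective. Evaluate the sum at a triple of tabloids which all have \<open>n + 1\<close> in the first row.
  A translate by \<open>\<tau>\<close> contributes only if \<open>\<tau>\<close> leaves \<open>n + 1\<close> in all three first rows. Then
  \<open>n + 1\<close> and \<open>\<tau> (n + 1)\<close> both lie in the first row of each translated tabloid, so \<open>\<tau>\<close> may be
  followed by their transposition without changing these tabloids. The product fixes \<open>n + 1\<close>, and
  therefore the contribution is the value of \<open>K\<close> at the triple without \<open>n + 1\<close>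
  (\<open>delete_entry_act\<close>). The whole sum is a positive multiple of that value. In terms of monomials
  \<open>x\<^sub>i\<^sub>j\<^sub>k\<close> indexed by triples of rows, the map is, up to factors which are positive integers,
  multiplication by \<open>x\<^sub>1\<^sub>1\<^sub>1\<close>.
\<close>

section \<open>Dimension and pointwise sums\<close>

lemma sum_fun_apply: "(\<Sum>i\<in>I. f i) x = (\<Sum>i\<in>I. f i x)"
  for f :: "'i \<Rightarrow> 'x \<Rightarrow> 'b::comm_monoid_add"
  by (induction I rule: infinite_finite_induct) auto

text \<open>The dimension of an infinite-dimensional space is \<open>0\<close> by convention, so the target must be
  known to lie in a finitely generated space.\<close>

lemma map_space_dim_le_of_injective:
  assumes lin: "module_hom scale_map scale_map \<Phi>"
    and sub: "map_space.subspace U"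
    and maps: "\<And>f. f \<in> U \<Longrightarrow> \<Phi> f \<in> U'"
    and inj: "\<And>f. f \<in> U \<Longrightarrow> \<Phi> f = 0 \<Longrightarrow> f = 0"
    and fin: "finite T" "U' \<subseteq> map_space.span T"
  shows "map_space.dim U \<le> map_space.dim U'"
proof -
  obtain B where B: "B \<subseteq> U" "map_space.independent B" "U \<subseteq> map_space.span B"
      "card B = map_space.dim U"
    by (rule map_space.basis_exists)
  obtain C where C: "C \<subseteq> U'" "map_space.independent C" "U' \<subseteq> map_space.span C"
      "card C = map_space.dim U'"
    by (rule map_space.basis_exists)
  have finC: "finite C"
    using map_space.independent_span_bound[OF fin(1) C(2)] C(1) fin(2) by blast
  have span: "map_space.span B \<subseteq> U"
    using B(1) sub by (rule map_space.span_minimal)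
  have injB: "inj_on \<Phi> (map_space.span B)"
    using inj span by (subst module_hom.inj_on_iff_eq_0[OF lin map_space.subspace_span]) blast
  have "map_space.independent (\<Phi> ` B)"
    using module_hom.independent_injective_image[OF lin B(2) injB] .
  moreover have "\<Phi> ` B \<subseteq> map_space.span C"
    using maps B(1) C(3) by blast
  ultimately have "card (\<Phi> ` B) \<le> card C"
    using map_space.independent_span_bound[OF finC] by blast
  moreover have "card (\<Phi> ` B) = card B"
    using injB map_space.span_superset by (intro card_image) (rule inj_on_subset)
  ultimately show ?thesis using B(4) C(4) by simp
qed

section \<open>Reproducing kernels of spaces of functions on a finite set\<close>

text \<open>For \<open>V\<close> a subspace of the functions supported on \<open>X\<close>, this says that \<open>p\<close> is the matrix of the
  orthogonal projection onto \<open>V\<close>, with respect to the standard form on functions on \<open>X\<close>.\<close>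

definition reproducing_kernel ::
    "'x set \<Rightarrow> ('x \<Rightarrow> rat) set \<Rightarrow> ('x \<Rightarrow> 'x \<Rightarrow> rat) \<Rightarrow> bool" where
  "reproducing_kernel X V p \<longleftrightarrow> (\<forall>x. p x \<in> V) \<and> (\<forall>x y. p x y = p y x) \<and>
     (\<forall>v\<in>V. \<forall>y. v y = (\<Sum>x\<in>X. v x * p x y))"

text \<open>Orthogonalization without normalization, as square roots are not available over the
  rationals: the projection kernel is the sum of \<open>c x * c y / \<langle>c, c\<rangle>\<close> over an orthogonal basis, which
  is built up one vector at a time.\<close>

lemma reproducing_kernel_span:
  assumes "finite X" "finite B" and "\<And>b x. b \<in> B \<Longrightarrow> x \<notin> X \<Longrightarrow> b x = 0"
  shows "\<exists>p. reproducing_kernel X (fun_space.span B) p"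
  using assms(2,3)
proof (induction B rule: finite_induct)
  case empty
  show ?case
    by (rule exI[of _ "\<lambda>x y. 0"])
      (auto simp: reproducing_kernel_def zero_fun_def[symmetric])
next
  case (insert b B)
  then obtain p where p: "reproducing_kernel X (fun_space.span B) p" by auto
  have pmem: "p x \<in> fun_space.span B" and psym: "p x y = p y x" for x y
    using p by (auto simp: reproducing_kernel_def)
  have prep: "v y = (\<Sum>x\<in>X. v x * p x y)" if "v \<in> fun_space.span B" for v y
    using p that by (auto simp: reproducing_kernel_def)
  let ?V = "fun_space.span (insert b B)"
  have mono: "fun_space.span B \<subseteq> ?V" by (rule fun_space.span_mono) auto
  \<comment> \<open>The component of \<open>b\<close> orthogonal to the span of \<open>B\<close>.\<close>
  define q where "q = (\<Sum>x\<in>X. scale_fun (b x) (p x))"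
  define c where "c = b - q"
  have q: "q \<in> fun_space.span B"
    unfolding q_def by (intro fun_space.span_sum fun_space.span_scale pmem)
  have cV: "c \<in> ?V"
    unfolding c_def using q mono by (auto intro: fun_space.span_diff fun_space.span_base)
  have supp: "v x = 0" if "v \<in> ?V" "x \<notin> X" for v x
    using that(1) insert.prems that(2)
    by (induction rule: fun_space.span_induct_alt) (auto simp: scale_fun_def)
  have q_apply: "q y = (\<Sum>x\<in>X. b x * p x y)" for y
    by (simp add: q_def sum_fun_apply scale_fun_def)
  have orth_p: "(\<Sum>x\<in>X. c x * p x y) = 0" for y
    using prep[OF q, of y] q_apply[of y]
    by (simp add: c_def left_diff_distrib sum_subtractf)
  have orth: "(\<Sum>x\<in>X. v x * c x) = 0" if "v \<in> fun_space.span B" for v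
  proof -
    have "(\<Sum>x\<in>X. v x * c x) = (\<Sum>x\<in>X. \<Sum>y\<in>X. v y * p y x * c x)"
      by (subst prep[OF that]) (simp add: sum_distrib_right)
    also have "\<dots> = (\<Sum>y\<in>X. v y * (\<Sum>x\<in>X. c x * p x y))"
      by (subst sum.swap) (simp add: sum_distrib_left psym mult_ac)
    finally show ?thesis by (simp add: orth_p)
  qed
  define N where "N = (\<Sum>x\<in>X. c x * c x)"
  \<comment> \<open>If \<open>c = 0\<close>, then also \<open>N = 0\<close>, and division by zero leaves the kernel as it was.\<close>
  define p' where "p' x y = p x y + c x * c y / N" for x y
  have c0: "c = 0" if "N = 0"
  proof
    fix x
    have "\<forall>x\<in>X. c x * c x = 0"
      using that assms(1) unfolding N_def by (subst (asm) sum_nonneg_eq_0_iff) auto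
    then show "c x = 0 x" using supp[OF cV] by (cases "x \<in> X") auto
  qed
  have bc: "b = c + q" by (simp add: c_def)
  have "reproducing_kernel X ?V p'"
    unfolding reproducing_kernel_def
  proof (intro conjI allI ballI)
    fix x
    have "p' x = p x + scale_fun (c x / N) c"
      by (auto simp: p'_def scale_fun_def)
    then show "p' x \<in> ?V"
      using pmem mono cV by (auto intro!: fun_space.span_add fun_space.span_scale)
  next
    fix x y show "p' x y = p' y x" by (simp add: p'_def psym mult.commute)
  next
    fix v y assume "v \<in> ?V"
    then obtain k where "v - scale_fun k b \<in> fun_space.span B"
      using fun_space.span_breakdown_eq by blast
    moreover define w where "w = v - scale_fun k b + scale_fun k q"
    ultimately have w: "w \<in> fun_space.span B"
      using q by (auto intro: fun_space.span_add fun_space.span_scale)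
    have v: "v = w + scale_fun k c"
      by (simp add: w_def c_def scale_fun_def algebra_simps fun_eq_iff)
    have "v x * p' x y = w x * p x y + w x * c x * (c y / N) + k * (c x * p x y) +
        k * (c x * c x) * (c y / N)" for x
      by (simp add: v p'_def scale_fun_def distrib_left distrib_right add_divide_distrib mult_ac)
    then have "(\<Sum>x\<in>X. v x * p' x y) = (\<Sum>x\<in>X. w x * p x y) +
        (\<Sum>x\<in>X. w x * c x) * (c y / N) + k * (\<Sum>x\<in>X. c x * p x y) + k * N * (c y / N)"
      by (simp only: sum.distrib sum_distrib_left sum_distrib_right N_def)
    also have "\<dots> = w y + k * N * (c y / N)"
      using prep[OF w, of y] orth[OF w] orth_p by simp
    also have "\<dots> = v y" using c0 by (auto simp: v scale_fun_def)
    finally show "v y = (\<Sum>x\<in>X. v x * p' x y)" by simp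
  qed
  then show ?case by blast
qed

lemma span_indicators:
  assumes "finite X" and "\<And>x. x \<notin> X \<Longrightarrow> v x = (0::rat)"
  shows "v = (\<Sum>x\<in>X. scale_fun (v x) (\<lambda>y. of_bool (y = x)))"
proof
  fix y
  have "(\<Sum>x\<in>X. v x * of_bool (y = x)) = (\<Sum>x\<in>X. if x = y then v x else 0)"
    by (intro sum.cong) auto
  then show "v y = (\<Sum>x\<in>X. scale_fun (v x) (\<lambda>y. of_bool (y = x))) y"
    using assms by (auto simp: sum_fun_apply scale_fun_def)
qed

lemma reproducing_kernel_exists:
  assumes X: "finite X" and V: "fun_space.subspace V"
    and supp: "\<And>v x. v \<in> V \<Longrightarrow> x \<notin> X \<Longrightarrow> v x = 0"
  shows "\<exists>p. reproducing_kernel X V p"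
proof -
  obtain B where B: "B \<subseteq> V" "fun_space.independent B" "V \<subseteq> fun_space.span B"
    by (rule fun_space.maximal_independent_subset)
  let ?D = "(\<lambda>x y. of_bool (y = x) :: rat) ` X"
  have "v \<in> fun_space.span ?D" if "v \<in> V" for v
    by (subst span_indicators[OF X supp[OF that]])
      (auto intro!: fun_space.span_sum fun_space.span_scale intro: fun_space.span_base)
  then have "finite B"
    using fun_space.independent_span_bound[of ?D B] B X by blast
  then have "\<exists>p. reproducing_kernel X (fun_space.span B) p"
    using B(1) supp X by (intro reproducing_kernel_span) auto
  moreover have "fun_space.span B = V"
    using B fun_space.span_minimal[OF B(1) V] by auto
  ultimately show ?thesis by simp
qed

text \<open>The inner product \<open>\<langle>p x, q y\<rangle>\<close> is evaluated in two ways: reproducing \<open>p x\<close> by \<open>q\<close> gives \<open>p x y\<close>, and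
  reproducing \<open>q y\<close> by \<open>p\<close> gives \<open>q y x\<close>.\<close>

lemma reproducing_kernel_unique:
  assumes p: "reproducing_kernel X V p" and q: "reproducing_kernel X V q"
  shows "p = q"
proof (intro ext)
  fix x y
  have mem: "p x \<in> V" "q y \<in> V" and sym: "p x y = p y x" "q x y = q y x" for x y
    using p q by (auto simp: reproducing_kernel_def)
  have rep: "v y = (\<Sum>z\<in>X. v z * p z y)" "v y = (\<Sum>z\<in>X. v z * q z y)" if "v \<in> V" for v y
    using p q that by (auto simp: reproducing_kernel_def)
  have "p x y = (\<Sum>z\<in>X. p x z * q z y)"
    using mem(1) by (rule rep(2))
  also have "\<dots> = (\<Sum>z\<in>X. q y z * p z x)"
    by (intro sum.cong refl) (metis sym mult.commute)
  also have "\<dots> = q y x"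
    using mem(2) by (rule rep(1)[symmetric])
  also have "\<dots> = q x y" by (rule sym)
  finally show "p x y = q x y" .
qed

section \<open>Equivariant maps and invariant kernels\<close>

text \<open>A subrepresentation \<open>V\<close> of the permutation representation on functions supported on a finite
  set \<open>X\<close> of points. Since the group is closed under inverses, stability of \<open>V\<close> may be stated with
  \<open>\<sigma>\<close> in place of its inverse.\<close>

locale permutation_rep =
  fixes A :: "'a set" and ac :: "('a \<Rightarrow> 'a) \<Rightarrow> 'x \<Rightarrow> 'x" and X :: "'x set"
    and V :: "('x \<Rightarrow> rat) set"
  assumes finite_degree: "finite A" and finite_points: "finite X"
    and ac_id: "ac id x = x" and ac_comp: "ac (\<sigma> \<circ> \<tau>) x = ac \<sigma> (ac \<tau> x)"
    and ac_points: "\<sigma> permutes A \<Longrightarrow> x \<in> X \<Longrightarrow> ac \<sigma> x \<in> X"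
    and subspace: "fun_space.subspace V"
    and support: "v \<in> V \<Longrightarrow> x \<notin> X \<Longrightarrow> v x = 0"
    and invariant: "\<sigma> permutes A \<Longrightarrow> v \<in> V \<Longrightarrow> (\<lambda>x. v (ac \<sigma> x)) \<in> V"
begin

definition rep :: "('a \<Rightarrow> 'a) \<Rightarrow> ('x \<Rightarrow> rat) \<Rightarrow> 'x \<Rightarrow> rat" where
  "rep \<sigma> v = (\<lambda>x. v (ac (inv \<sigma>) x))"

lemma ac_inv:
  assumes "\<sigma> permutes A"
  shows "ac (inv \<sigma>) (ac \<sigma> x) = x" "ac \<sigma> (ac (inv \<sigma>) x) = x"
  using permutes_inv_o[OF assms] ac_comp ac_id by metis+

lemma sum_points_ac:
  assumes "\<sigma> permutes A"
  shows "(\<Sum>x\<in>X. g (ac \<sigma> x)) = (\<Sum>x\<in>X. g x)"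
  by (rule sum.reindex_bij_witness[where i = "ac (inv \<sigma>)" and j = "ac \<sigma>"])
    (auto simp: assms ac_inv ac_points permutes_inv)

definition rk :: "'x \<Rightarrow> 'x \<Rightarrow> rat" where
  "rk = (SOME p. reproducing_kernel X V p)"

lemma reproducing_kernel_rk: "reproducing_kernel X V rk"
proof -
  have "\<exists>p. reproducing_kernel X V p"
    using finite_points subspace support by (rule reproducing_kernel_exists)
  then show ?thesis unfolding rk_def by (rule someI_ex)
qed

lemma rk_mem: "rk x \<in> V"
  and rk_sym: "rk x y = rk y x"
  and rk_reproduces: "v \<in> V \<Longrightarrow> v y = (\<Sum>x\<in>X. v x * rk x y)"
  using reproducing_kernel_rk by (auto simp: reproducing_kernel_def)

lemma rk_expansion: "v \<in> V \<Longrightarrow> v = (\<Sum>x\<in>X. scale_fun (v x) (rk x))"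
  by (rule ext) (simp add: sum_fun_apply scale_fun_def rk_reproduces[symmetric])

text \<open>By uniqueness, as translating a reproducing kernel of a stable space gives another one.\<close>

lemma rk_invariant:
  assumes \<sigma>: "\<sigma> permutes A"
  shows "rk (ac \<sigma> x) (ac \<sigma> y) = rk x y"
proof -
  have "reproducing_kernel X V (\<lambda>x y. rk (ac \<sigma> x) (ac \<sigma> y))"
    unfolding reproducing_kernel_def
  proof (intro conjI allI ballI)
    fix x show "(\<lambda>y. rk (ac \<sigma> x) (ac \<sigma> y)) \<in> V"
      using \<sigma> rk_mem by (rule invariant)
  next
    fix x y show "rk (ac \<sigma> x) (ac \<sigma> y) = rk (ac \<sigma> y) (ac \<sigma> x)" by (rule rk_sym)
  next
    fix v y assume "v \<in> V"
    then have "(\<lambda>x. v (ac (inv \<sigma>) x)) \<in> V"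
      using \<sigma> by (intro invariant permutes_inv)
    from rk_reproduces[OF this, of "ac \<sigma> y"]
    have "v y = (\<Sum>x\<in>X. v (ac (inv \<sigma>) x) * rk x (ac \<sigma> y))" by (simp add: ac_inv \<sigma>)
    also have "\<dots> = (\<Sum>x\<in>X. v x * rk (ac \<sigma> x) (ac \<sigma> y))"
      by (subst sum_points_ac[OF \<sigma>, symmetric]) (simp add: ac_inv \<sigma>)
    finally show "v y = (\<Sum>x\<in>X. v x * rk (ac \<sigma> x) (ac \<sigma> y))" .
  qed
  from reproducing_kernel_unique[OF this reproducing_kernel_rk] show ?thesis
    by (simp add: fun_eq_iff)
qed

lemma rep_rk: "\<sigma> permutes A \<Longrightarrow> rep \<sigma> (rk x) = rk (ac \<sigma> x)"
  using rk_invariant[of \<sigma> x] by (auto simp: rep_def ac_inv fun_eq_iff) (metis ac_inv(2))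

end

locale permutation_rep_pair =
  dom: permutation_rep A acX X V + cod: permutation_rep A acZ Z W
  for A :: "'a set" and acX :: "('a \<Rightarrow> 'a) \<Rightarrow> 'x \<Rightarrow> 'x" and X V
    and acZ :: "('a \<Rightarrow> 'a) \<Rightarrow> 'z \<Rightarrow> 'z" and Z W
begin

abbreviation Hom :: "(('x \<Rightarrow> rat) \<Rightarrow> 'z \<Rightarrow> rat) set" where
  "Hom \<equiv> equivariant_maps {\<sigma>. \<sigma> permutes A} dom.rep cod.rep V W"

lemma subspace_Hom: "map_space.subspace Hom"
  by (rule subspace_equivariant_maps)
    (auto simp: cod.subspace cod.rep_def scale_fun_def)

text \<open>The invariants of \<open>V \<otimes> W\<close>. Membership in the tensor product is expressed slicewise, which
  spares decompositions into pure tensors.\<close>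

definition invariant_kernels :: "('x \<Rightarrow> 'z \<Rightarrow> rat) set" where
  "invariant_kernels = {K. (\<forall>x. K x \<in> W) \<and> (\<forall>z. (\<lambda>x. K x z) \<in> V) \<and>
     (\<forall>\<sigma> x z. \<sigma> permutes A \<longrightarrow> K (acX \<sigma> x) (acZ \<sigma> z) = K x z)}"

text \<open>Composing \<open>f\<close> with the projection onto \<open>V\<close> gives a matrix for \<open>f\<close> that depends linearly on \<open>f\<close>
  and whose columns lie in \<open>V\<close>.\<close>

definition kernel_of :: "(('x \<Rightarrow> rat) \<Rightarrow> 'z \<Rightarrow> rat) \<Rightarrow> 'x \<Rightarrow> 'z \<Rightarrow> rat" where
  "kernel_of f x z = f (dom.rk x) z"

definition map_of_kernel :: "('x \<Rightarrow> 'z \<Rightarrow> rat) \<Rightarrow> ('x \<Rightarrow> rat) \<Rightarrow> 'z \<Rightarrow> rat" where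
  "map_of_kernel K v = (if v \<in> V then (\<lambda>z. \<Sum>x\<in>X. v x * K x z) else 0)"

lemma Hom_sum:
  assumes f: "f \<in> Hom" and "finite I" and g: "\<And>i. i \<in> I \<Longrightarrow> g i \<in> V"
  shows "f (\<Sum>i\<in>I. scale_fun (c i) (g i)) = (\<Sum>i\<in>I. scale_fun (c i) (f (g i)))"
  using assms(2) g
proof (induction I rule: finite_induct)
  case empty
  have "f (scale_fun 0 0) = scale_fun 0 (f 0)"
    using f fun_space.subspace_0[OF dom.subspace] unfolding equivariant_maps_def by blast
  then show ?case by (simp only: fun_space.scale_zero_left sum.empty)
next
  case (insert i I)
  have V: "(\<Sum>i\<in>I. scale_fun (c i) (g i)) \<in> V" "scale_fun (c i) (g i) \<in> V" "g i \<in> V"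
    using insert.prems
    by (auto intro!: fun_space.subspace_sum fun_space.subspace_scale dom.subspace)
  have "f (scale_fun (c i) (g i) + (\<Sum>i\<in>I. scale_fun (c i) (g i))) =
      scale_fun (c i) (f (g i)) + f (\<Sum>i\<in>I. scale_fun (c i) (g i))"
    using f V unfolding equivariant_maps_def by auto
  moreover have "f (\<Sum>i\<in>I. scale_fun (c i) (g i)) = (\<Sum>i\<in>I. scale_fun (c i) (f (g i)))"
    using insert by blast
  ultimately show ?case
    by (simp only: sum.insert[OF insert.hyps])
qed

lemma Hom_expansion:
  assumes "f \<in> Hom" "v \<in> V"
  shows "f v = (\<Sum>x\<in>X. scale_fun (v x) (f (dom.rk x)))"
proof -
  have "f v = f (\<Sum>x\<in>X. scale_fun (v x) (dom.rk x))"
    using dom.rk_expansion[OF assms(2)] by (rule arg_cong)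
  then show ?thesis
    by (simp only: Hom_sum[OF assms(1) dom.finite_points dom.rk_mem])
qed

lemma map_of_kernel_of:
  assumes "f \<in> Hom"
  shows "map_of_kernel (kernel_of f) = f"
proof
  fix v
  show "map_of_kernel (kernel_of f) v = f v"
  proof (cases "v \<in> V")
    case True
    have "map_of_kernel (kernel_of f) v = (\<Sum>x\<in>X. scale_fun (v x) (f (dom.rk x)))"
      using True by (auto simp: map_of_kernel_def kernel_of_def sum_fun_apply scale_fun_def)
    then show ?thesis by (simp only: Hom_expansion[OF assms True])
  next
    case False
    then show ?thesis
      using assms by (auto simp: map_of_kernel_def equivariant_maps_def)
  qed
qed

text \<open>The slices with \<open>z\<close> fixed lie in \<open>V\<close>: expanding \<open>rk x\<close> in the vectors \<open>rk y\<close> and applying \<open>f\<close>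
  writes such a slice as a combination of the \<open>rk y\<close>, by symmetry of \<open>rk\<close>.\<close>

lemma kernel_of_invariant:
  assumes f: "f \<in> Hom"
  shows "kernel_of f \<in> invariant_kernels"
  unfolding invariant_kernels_def
proof (intro CollectI conjI allI impI)
  fix x show "kernel_of f x \<in> W"
    using f dom.rk_mem by (auto simp: kernel_of_def[abs_def] equivariant_maps_def)
next
  fix z
  have "(\<lambda>x. kernel_of f x z) = (\<Sum>y\<in>X. scale_fun (kernel_of f y z) (dom.rk y))"
  proof
    fix x
    have "f (dom.rk x) z = (\<Sum>y\<in>X. dom.rk x y * f (dom.rk y) z)"
      using arg_cong[OF Hom_expansion[OF f dom.rk_mem[of x]], of "\<lambda>w. w z"]
      by (simp add: sum_fun_apply scale_fun_def)
    then show "kernel_of f x z = (\<Sum>y\<in>X. scale_fun (kernel_of f y z) (dom.rk y)) x"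
      by (simp add: kernel_of_def sum_fun_apply scale_fun_def dom.rk_sym[of x] mult.commute)
  qed
  then show "(\<lambda>x. kernel_of f x z) \<in> V"
    by (auto intro!: fun_space.subspace_sum fun_space.subspace_scale dom.subspace dom.rk_mem)
next
  fix \<sigma> x z assume \<sigma>: "\<sigma> permutes A"
  have "f (dom.rep \<sigma> (dom.rk x)) = cod.rep \<sigma> (f (dom.rk x))"
    using f dom.rk_mem \<sigma> by (auto simp: equivariant_maps_def)
  then show "kernel_of f (acX \<sigma> x) (acZ \<sigma> z) = kernel_of f x z"
    by (simp add: kernel_of_def dom.rep_rk[OF \<sigma>] cod.rep_def cod.ac_inv[OF \<sigma>])
qed

lemma map_of_kernel_equivariant:
  assumes K: "K \<in> invariant_kernels"
  shows "map_of_kernel K \<in> Hom"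
proof -
  have KW: "K x \<in> W" for x using K by (simp add: invariant_kernels_def)
  have Kinv: "K (acX \<sigma> x) (acZ \<sigma> z) = K x z" if "\<sigma> permutes A" for \<sigma> x z
    using K that by (simp add: invariant_kernels_def)
  have eq: "map_of_kernel K v = (\<Sum>x\<in>X. scale_fun (v x) (K x))" if "v \<in> V" for v
    using that by (auto simp: map_of_kernel_def sum_fun_apply scale_fun_def)
  have "map_of_kernel K (dom.rep \<sigma> v) = cod.rep \<sigma> (map_of_kernel K v)"
    if \<sigma>: "\<sigma> permutes A" and v: "v \<in> V" for \<sigma> v
  proof
    fix z
    have "dom.rep \<sigma> v \<in> V"
      using dom.invariant[OF permutes_inv[OF \<sigma>] v] by (simp add: dom.rep_def)
    then have "map_of_kernel K (dom.rep \<sigma> v) z = (\<Sum>x\<in>X. v (acX (inv \<sigma>) x) * K x z)"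
      by (simp add: map_of_kernel_def dom.rep_def)
    also have "\<dots> = (\<Sum>x\<in>X. v x * K (acX \<sigma> x) z)"
      by (subst dom.sum_points_ac[OF \<sigma>, symmetric]) (simp add: dom.ac_inv \<sigma>)
    also have "\<dots> = (\<Sum>x\<in>X. v x * K x (acZ (inv \<sigma>) z))"
      using Kinv[OF \<sigma>, of x "acZ (inv \<sigma>) z" for x] by (simp add: cod.ac_inv[OF \<sigma>])
    finally show "map_of_kernel K (dom.rep \<sigma> v) z = cod.rep \<sigma> (map_of_kernel K v) z"
      using v by (simp add: map_of_kernel_def cod.rep_def)
  qed
  moreover have "map_of_kernel K v \<in> W" if "v \<in> V" for v
    unfolding eq[OF that]
    by (auto intro!: fun_space.subspace_sum fun_space.subspace_scale cod.subspace KW)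
  moreover have "u + v \<in> V" "scale_fun c v \<in> V" if "u \<in> V" "v \<in> V" for u v c
    using that dom.subspace by (auto intro: fun_space.subspace_add fun_space.subspace_scale)
  ultimately show ?thesis
    unfolding equivariant_maps_def
    by (auto simp: eq fun_space.scale_left_distrib sum.distrib fun_space.scale_sum_right)
      (auto simp: map_of_kernel_def scale_fun_def distrib_right sum.distrib)
qed

text \<open>Each slice of the kernel lies in \<open>V\<close>, so the map may be applied to it; the result contains the
  square norm of the slice.\<close>

lemma map_of_kernel_eq_0:
  assumes K: "K \<in> invariant_kernels" and 0: "map_of_kernel K = 0"
  shows "K = 0"
proof (intro ext)
  fix x z
  have V: "(\<lambda>x. K x z) \<in> V" using K by (simp add: invariant_kernels_def)
  have "(\<Sum>x\<in>X. K x z * K x z) = map_of_kernel K (\<lambda>x. K x z) z"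
    using V by (simp add: map_of_kernel_def)
  then have "(\<Sum>x\<in>X. K x z * K x z) = 0" by (simp add: 0)
  then have "\<forall>x\<in>X. K x z = 0"
    using dom.finite_points by (subst (asm) sum_nonneg_eq_0_iff) auto
  then show "K x z = 0 x z" using dom.support[OF V] by (cases "x \<in> X") auto
qed

text \<open>The maps with matrix units as kernels generate; they need not be equivariant themselves.\<close>

lemma Hom_finite_dim: "\<exists>T. finite T \<and> Hom \<subseteq> map_space.span T"
proof -
  define E where "E = (\<lambda>(x, z). map_of_kernel (\<lambda>x' z'. of_bool (x' = x \<and> z' = z)))"
  have "f \<in> map_space.span (E ` (X \<times> Z))" if f: "f \<in> Hom" for f
  proof -
    have "f = (\<Sum>(x, z)\<in>X \<times> Z. scale_map (kernel_of f x z) (E (x, z)))" (is "_ = ?g")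
    proof (intro ext)
      fix v z
      have supp: "kernel_of f x z = 0" if "z \<notin> Z" for x
        using kernel_of_invariant[OF f] cod.support[OF _ that]
        by (auto simp: invariant_kernels_def)
      have E: "E (x, z') v z = (if v \<in> V \<and> z' = z then v x else 0)" if "x \<in> X" for x z'
      proof -
        have "(\<Sum>y\<in>X. v y * of_bool (y = x \<and> z = z')) =
            (\<Sum>y\<in>X. if y = x then (if z' = z then v x else 0) else 0)"
          by (intro sum.cong) auto
        then show ?thesis
          using that dom.finite_points by (auto simp: E_def map_of_kernel_def)
      qed
      have "?g v z = (\<Sum>x\<in>X. \<Sum>z'\<in>Z. kernel_of f x z' * E (x, z') v z)"
        by (simp add: sum_fun_apply scale_map_def scale_fun_def case_prod_unfold
            sum.cartesian_product)
      also have "\<dots> = (\<Sum>x\<in>X. \<Sum>z'\<in>Z. if z' = z then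
          kernel_of f x z * (if v \<in> V then v x else 0) else 0)"
        by (intro sum.cong) (auto simp: E)
      also have "\<dots> = (\<Sum>x\<in>X. kernel_of f x z * (if v \<in> V then v x else 0))"
        using cod.finite_points supp by (intro sum.cong) auto
      also have "\<dots> = map_of_kernel (kernel_of f) v z"
        by (auto simp: map_of_kernel_def mult.commute intro!: sum.cong)
      finally show "f v z = ?g v z" by (simp add: map_of_kernel_of[OF f])
    qed
    also have "?g \<in> map_space.span (E ` (X \<times> Z))"
      by (auto intro!: map_space.span_sum map_space.span_scale intro: map_space.span_base)
    finally show ?thesis .
  qed
  then show ?thesis
    using dom.finite_points cod.finite_points by (intro exI[of _ "E ` (X \<times> Z)"]) auto
qed

end

section \<open>Comparing equivariant maps for two groups\<close>

text \<open>If \<open>J\<close> is the image of an injection of points and \<open>r\<close> inverts it, this is the push-forward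
  along the injection.\<close>

definition extend_by_zero :: "'x set \<Rightarrow> ('x \<Rightarrow> 'x) \<Rightarrow> ('x \<Rightarrow> rat) \<Rightarrow> 'x \<Rightarrow> rat" where
  "extend_by_zero J r v = (\<lambda>x. if x \<in> J then v (r x) else 0)"

text \<open>The sum of all translates under the large group of a kernel extended by zero is an invariant
  kernel. By \<open>descend\<close>, two points of \<open>J \<times> L\<close> in one orbit of the large group come from a single
  orbit of the small one. Hence all nonzero summands of the value at a point of
  \<open>J \<times> L\<close> are equal, and nothing cancels.\<close>

lemma dim_Hom_le:
  fixes acX :: "('a \<Rightarrow> 'a) \<Rightarrow> 'x \<Rightarrow> 'x" and acZ :: "('a \<Rightarrow> 'a) \<Rightarrow> 'z \<Rightarrow> 'z"
  assumes small: "permutation_rep_pair A acX X V acZ Z W"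
    and large: "permutation_rep_pair B acX X' V' acZ Z' W'"
    and extV: "\<And>v. v \<in> V \<Longrightarrow> extend_by_zero J r v \<in> V'"
    and extW: "\<And>w. w \<in> W \<Longrightarrow> extend_by_zero L s w \<in> W'"
    and X_image: "X \<subseteq> r ` J" and Z_image: "Z \<subseteq> s ` L"
    and descend: "\<And>\<tau>. \<tau> permutes B \<Longrightarrow> \<exists>\<tau>'. \<tau>' permutes A \<and>
      (\<forall>x\<in>J. acX \<tau> x \<in> J \<longrightarrow> r (acX \<tau> x) = acX \<tau>' (r x)) \<and>
      (\<forall>z\<in>L. acZ \<tau> z \<in> L \<longrightarrow> s (acZ \<tau> z) = acZ \<tau>' (s z))"
  shows "map_space.dim (permutation_rep_pair.Hom A acX V acZ W) \<le>
    map_space.dim (permutation_rep_pair.Hom B acX V' acZ W')"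
proof -
  interpret S: permutation_rep_pair A acX X V acZ Z W by fact
  interpret T: permutation_rep_pair B acX X' V' acZ Z' W' by fact
  let ?G = "{\<tau>. \<tau> permutes B}"
  have finG: "finite ?G" using T.dom.finite_degree by (rule finite_permutations)
  define ext where "ext K x z = (if x \<in> J \<and> z \<in> L then K (r x) (s z) else 0)"
    for K :: "'x \<Rightarrow> 'z \<Rightarrow> rat" and x z
  define avg where "avg K x z = (\<Sum>\<tau>\<in>?G. ext K (acX \<tau> x) (acZ \<tau> z))"
    for K :: "'x \<Rightarrow> 'z \<Rightarrow> rat" and x z
  have avg: "avg K \<in> T.invariant_kernels" if K: "K \<in> S.invariant_kernels" for K
    unfolding T.invariant_kernels_def
  proof (intro CollectI conjI allI impI)
    fix x
    have "ext K y \<in> W'" for y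
    proof (cases "y \<in> J")
      case True
      then have "ext K y = extend_by_zero L s (K (r y))"
        by (auto simp: ext_def extend_by_zero_def)
      then show ?thesis using K extW by (auto simp: S.invariant_kernels_def)
    next
      case False
      then have "ext K y = 0" by (auto simp: ext_def)
      then show ?thesis using fun_space.subspace_0[OF T.cod.subspace] by simp
    qed
    then have "(\<Sum>\<tau>\<in>?G. (\<lambda>z. ext K (acX \<tau> x) (acZ \<tau> z))) \<in> W'"
      by (intro fun_space.subspace_sum T.cod.subspace T.cod.invariant) auto
    moreover have "avg K x = (\<Sum>\<tau>\<in>?G. (\<lambda>z. ext K (acX \<tau> x) (acZ \<tau> z)))"
      by (auto simp: avg_def sum_fun_apply)
    ultimately show "avg K x \<in> W'" by simp
  next
    fix z
    have "(\<lambda>x. ext K x y) \<in> V'" for y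
    proof (cases "y \<in> L")
      case True
      then have "(\<lambda>x. ext K x y) = extend_by_zero J r (\<lambda>x. K x (s y))"
        by (auto simp: ext_def extend_by_zero_def)
      then show ?thesis using K extV by (auto simp: S.invariant_kernels_def)
    next
      case False
      then have "(\<lambda>x. ext K x y) = 0" by (auto simp: ext_def)
      then show ?thesis using fun_space.subspace_0[OF T.dom.subspace] by simp
    qed
    then have "(\<Sum>\<tau>\<in>?G. (\<lambda>x. ext K (acX \<tau> x) (acZ \<tau> z))) \<in> V'"
      by (intro fun_space.subspace_sum T.dom.subspace T.dom.invariant[of _ "\<lambda>x. ext K x y" for y])
        auto
    moreover have "(\<lambda>x. avg K x z) = (\<Sum>\<tau>\<in>?G. (\<lambda>x. ext K (acX \<tau> x) (acZ \<tau> z)))"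
      by (auto simp: avg_def sum_fun_apply)
    ultimately show "(\<lambda>x. avg K x z) \<in> V'" by simp
  next
    fix \<sigma> x z assume \<sigma>: "\<sigma> permutes B"
    show "avg K (acX \<sigma> x) (acZ \<sigma> z) = avg K x z"
      unfolding avg_def
      by (rule sum.reindex_bij_witness[where i = "\<lambda>\<tau>. \<tau> \<circ> inv \<sigma>" and j = "\<lambda>\<tau>. \<tau> \<circ> \<sigma>"])
        (auto simp: T.dom.ac_comp T.cod.ac_comp o_assoc[symmetric] permutes_inv_o[OF \<sigma>]
          intro: permutes_compose permutes_inv \<sigma>)
  qed
  have avg_inj: "K = 0" if K: "K \<in> S.invariant_kernels" and 0: "avg K = 0" for K
  proof (intro ext)
    fix x z
    show "K x z = 0 x z"
    proof (cases "x \<in> X \<and> z \<in> Z")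
      case True
      then obtain x' z' where x': "x' \<in> J" "x = r x'" and z': "z' \<in> L" "z = s z'"
        using X_image Z_image by blast
      let ?H = "{\<tau> \<in> ?G. acX \<tau> x' \<in> J \<and> acZ \<tau> z' \<in> L}"
      have "ext K (acX \<tau> x') (acZ \<tau> z') = (if acX \<tau> x' \<in> J \<and> acZ \<tau> z' \<in> L then K x z else 0)"
        if \<tau>: "\<tau> \<in> ?G" for \<tau>
      proof -
        obtain \<tau>' where "\<tau>' permutes A"
            "acX \<tau> x' \<in> J \<Longrightarrow> r (acX \<tau> x') = acX \<tau>' x"
            "acZ \<tau> z' \<in> L \<Longrightarrow> s (acZ \<tau> z') = acZ \<tau>' z"
          using descend[of \<tau>] \<tau> x' z' by blast
        then show ?thesis using K by (auto simp: ext_def S.invariant_kernels_def)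
      qed
      then have "avg K x' z' = (\<Sum>\<tau>\<in>?G. if acX \<tau> x' \<in> J \<and> acZ \<tau> z' \<in> L then K x z else 0)"
        unfolding avg_def by (intro sum.cong) auto
      also have "\<dots> = (\<Sum>\<tau>\<in>?H. K x z)"
        using finG by (rule sum.inter_filter[symmetric])
      finally have "of_nat (card ?H) * K x z = 0" by (simp add: 0)
      \<comment> \<open>The summand of the identity ensures that the multiple is not zero.\<close>
      moreover have "id \<in> ?H"
        using x' z' by (auto simp: T.dom.ac_id T.cod.ac_id permutes_id)
      then have "card ?H \<noteq> 0" using finG by auto
      ultimately show ?thesis by simp
    next
      case False
      have "K x \<in> W" "(\<lambda>x. K x z) \<in> V" using K by (auto simp: S.invariant_kernels_def)
      then show ?thesis using False S.dom.support S.cod.support by fastforce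
    qed
  qed
  define \<Phi> where "\<Phi> f = T.map_of_kernel (avg (S.kernel_of f))" for f
  obtain D where D: "finite D" "T.Hom \<subseteq> map_space.span D" using T.Hom_finite_dim by blast
  show ?thesis
  proof (rule map_space_dim_le_of_injective[where \<Phi> = \<Phi>, OF _ S.subspace_Hom _ _ D])
    have avg_add: "avg (S.kernel_of (f + g)) x z = avg (S.kernel_of f) x z + avg (S.kernel_of g) x z"
      for f g x z
      unfolding avg_def sum.distrib[symmetric]
      by (intro sum.cong) (auto simp: ext_def S.kernel_of_def)
    have avg_scale: "avg (S.kernel_of (scale_map c f)) x z = c * avg (S.kernel_of f) x z"
      for f c x z
      unfolding avg_def sum_distrib_left
      by (intro sum.cong) (auto simp: ext_def S.kernel_of_def scale_map_def scale_fun_def)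
    have "\<Phi> (f + g) = \<Phi> f + \<Phi> g" for f g
      by (auto simp: \<Phi>_def T.map_of_kernel_def avg_add fun_eq_iff sum.distrib distrib_left)
    moreover have "\<Phi> (scale_map c f) = scale_map c (\<Phi> f)" for c f
      unfolding \<Phi>_def T.map_of_kernel_def avg_scale
      by (auto simp: fun_eq_iff scale_map_def scale_fun_def sum_distrib_left mult_ac)
    ultimately show "module_hom scale_map scale_map \<Phi>"
      by unfold_locales
  next
    fix f assume f: "f \<in> S.Hom"
    show "\<Phi> f \<in> T.Hom"
      unfolding \<Phi>_def by (intro T.map_of_kernel_equivariant avg S.kernel_of_invariant f)
    show "f = 0" if "\<Phi> f = 0"
    proof -
      have "avg (S.kernel_of f) = 0"
        using that unfolding \<Phi>_def
        by (intro T.map_of_kernel_eq_0 avg S.kernel_of_invariant f)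
      then have "S.kernel_of f = 0" by (rule avg_inj[OF S.kernel_of_invariant[OF f]])
      moreover have "S.map_of_kernel 0 = 0"
        by (intro ext) (simp add: S.map_of_kernel_def)
      ultimately show ?thesis using S.map_of_kernel_of[OF f] by simp
    qed
  qed
qed

section \<open>Specht modules and their tensor products\<close>

lemma subspace_specht: "fun_space.subspace (specht n a)"
  by (simp add: specht_def)

lemma subspace_tensor: "fun_space.subspace (tensor V W)"
  by (simp add: tensor_def)

lemma pure_tensor_in_tensor: "v \<in> V \<Longrightarrow> w \<in> W \<Longrightarrow> pure_tensor v w \<in> tensor V W"
  unfolding tensor_def by (rule fun_space.span_base) blast

lemma vanishes_on_span:
  assumes "v \<in> fun_space.span S" and "\<And>b. b \<in> S \<Longrightarrow> b x = 0"
  shows "v x = 0"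
  using assms by (induction rule: fun_space.span_induct_alt) (auto simp: scale_fun_def)

text \<open>A finite set of points for the permutation representation that contains all tabloids of shape
  \<open>a\<close>. It is chosen generously, so that finiteness and stability are immediate.\<close>

definition row_sets :: "nat \<Rightarrow> (nat \<Rightarrow> nat) \<Rightarrow> (nat \<Rightarrow> nat set) set" where
  "row_sets n a = {T. (\<forall>i. T i \<subseteq> {1..n}) \<and> (\<forall>i. a i = 0 \<longrightarrow> T i = {})}"

lemma finite_row_sets:
  assumes "finite {i. a i \<noteq> 0}"
  shows "finite (row_sets n a)"
proof (rule finite_subset)
  let ?R = "{T. \<forall>i. (i \<in> {i. a i \<noteq> 0} \<longrightarrow> T i \<in> Pow {1..n}) \<and> (i \<notin> {i. a i \<noteq> 0} \<longrightarrow> T i = {})}"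
  show "row_sets n a \<subseteq> ?R" by (auto simp: row_sets_def)
  show "finite ?R" using assms by (rule finite_set_of_finite_funs) simp
qed

lemma act_tabloid_row_sets:
  assumes \<sigma>: "\<sigma> permutes {1..n}" and "T \<in> row_sets n a"
  shows "act_tabloid \<sigma> T \<in> row_sets n a"
  using assms(2) permutes_in_image[OF \<sigma>]
  by (auto simp: row_sets_def act_tabloid_def subset_iff)

lemma tabloid_row_sets: "is_tableau n a t \<Longrightarrow> tabloid a t \<in> row_sets n a"
  by (auto simp: row_sets_def tabloid_def is_tableau_def diagram_def dest!: bij_betwE)

lemma specht_support:
  assumes "v \<in> specht n a" "T \<notin> row_sets n a"
  shows "v T = 0"
  using assms(1) unfolding specht_def
proof (rule vanishes_on_span)
  fix b assume "b \<in> {polytabloid n a t | t. is_tableau n a t}"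
  then obtain t where "is_tableau n a t" "b = polytabloid n a t" by blast
  then show "b T = 0"
    using assms(2) act_tabloid_row_sets[OF _ tabloid_row_sets]
    by (auto simp: polytabloid_def column_stabilizer_def intro!: sum.neutral)
qed

lemma permutation_rep_specht:
  assumes "finite {i. a i \<noteq> 0}"
  shows "permutation_rep {1..n} act_tabloid (row_sets n a) (specht n a)"
proof
  fix \<sigma> v assume \<sigma>: "\<sigma> permutes {1..n}" and v: "v \<in> specht n a"
  have "act (inv \<sigma>) v \<in> specht n a"
    using v by (intro act_specht permutes_inv \<sigma>)
  then show "(\<lambda>T. v (act_tabloid \<sigma> T)) \<in> specht n a"
    by (simp add: act_def permutes_inv_inv[OF \<sigma>])
qed (auto simp: finite_row_sets[OF assms] act_tabloid_row_sets subspace_specht specht_support,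
    auto simp: act_tabloid_def)

lemma permutation_rep_tensor:
  assumes "permutation_rep A ac X V" "permutation_rep A ac' Y W"
  shows "permutation_rep A (\<lambda>\<sigma>. map_prod (ac \<sigma>) (ac' \<sigma>)) (X \<times> Y) (tensor V W)"
proof -
  interpret V: permutation_rep A ac X V by fact
  interpret W: permutation_rep A ac' Y W by fact
  show ?thesis
  proof
    fix u :: "'b \<times> 'c \<Rightarrow> rat" and p assume u: "u \<in> tensor V W" and p: "p \<notin> X \<times> Y"
    show "u p = 0"
      using u unfolding tensor_def
    proof (rule vanishes_on_span)
      fix b :: "'b \<times> 'c \<Rightarrow> rat" assume "b \<in> {pure_tensor v w | v w. v \<in> V \<and> w \<in> W}"
      then obtain v w where b: "b = pure_tensor v w" "v \<in> V" "w \<in> W" by blast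
      have "v (fst p) = 0 \<or> w (snd p) = 0"
        using p V.support[OF b(2)] W.support[OF b(3)] by (cases p) auto
      then show "b p = 0" by (auto simp: b(1) pure_tensor_def case_prod_unfold)
    qed
  next
    fix \<sigma> and u :: "'b \<times> 'c \<Rightarrow> rat" assume \<sigma>: "\<sigma> permutes A" and u: "u \<in> tensor V W"
    show "(\<lambda>p. u (map_prod (ac \<sigma>) (ac' \<sigma>) p)) \<in> tensor V W"
      using u unfolding tensor_def
    proof (induction rule: fun_space.span_induct_alt)
      case base
      show ?case using fun_space.span_zero by (simp add: zero_fun_def)
    next
      case (step c b u)
      then obtain v w where b: "b = pure_tensor v w" "v \<in> V" "w \<in> W" by blast
      have "(\<lambda>p. (scale_fun c b + u) (map_prod (ac \<sigma>) (ac' \<sigma>) p)) =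
          scale_fun c (pure_tensor (\<lambda>x. v (ac \<sigma> x)) (\<lambda>y. w (ac' \<sigma> y))) +
          (\<lambda>p. u (map_prod (ac \<sigma>) (ac' \<sigma>) p))"
        by (auto simp: b pure_tensor_def scale_fun_def)
      also have "\<dots> \<in> tensor V W"
        using step.IH pure_tensor_in_tensor[OF V.invariant[OF \<sigma> b(2)] W.invariant[OF \<sigma> b(3)]]
        unfolding tensor_def by (intro fun_space.span_add fun_space.span_scale)
      finally show ?case unfolding tensor_def .
    qed
  qed (auto simp: V.finite_degree V.finite_points W.finite_points V.ac_id W.ac_id V.ac_comp
      W.ac_comp V.ac_points W.ac_points subspace_tensor)
qed

section \<open>Adjoining a new entry to the first row\<close>

definition new_in_first_row :: "nat \<Rightarrow> (nat \<Rightarrow> nat set) set" where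
  "new_in_first_row m = {T. m \<in> T 0 \<and> (\<forall>i. i \<noteq> 0 \<longrightarrow> m \<notin> T i)}"

definition delete_entry :: "nat \<Rightarrow> (nat \<Rightarrow> nat set) \<Rightarrow> nat \<Rightarrow> nat set" where
  "delete_entry m T = (\<lambda>i. T i - {m})"

lemma row_sets_subset_delete_entry:
  "row_sets n a \<subseteq> delete_entry (Suc n) ` new_in_first_row (Suc n)"
proof
  fix T assume "T \<in> row_sets n a"
  then have T: "Suc n \<notin> T i" for i by (force simp: row_sets_def)
  show "T \<in> delete_entry (Suc n) ` new_in_first_row (Suc n)"
    by (rule image_eqI[of _ _ "T(0 := insert (Suc n) (T 0))"])
      (use T in \<open>auto simp: delete_entry_def new_in_first_row_def fun_eq_iff\<close>)
qed

text \<open>The permutation \<open>\<tau>\<close> is followed by the transposition of \<open>n + 1\<close> and \<open>\<tau> (n + 1)\<close>. Both numbers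
  lie in the first row of the translate, which is thus unchanged, and the product fixes \<open>n + 1\<close>. It
  depends on \<open>\<tau>\<close> only, so that it serves several tabloids simultaneously.\<close>

lemma delete_entry_act:
  assumes \<tau>: "\<tau> permutes {1..Suc n}"
  shows "\<exists>\<tau>'. \<tau>' permutes {1..n} \<and>
    (\<forall>T\<in>new_in_first_row (Suc n). act_tabloid \<tau> T \<in> new_in_first_row (Suc n) \<longrightarrow>
      delete_entry (Suc n) (act_tabloid \<tau> T) = act_tabloid \<tau>' (delete_entry (Suc n) T))"
proof (intro exI conjI ballI impI)
  let ?m = "Suc n" and ?\<tau>' = "transpose (Suc n) (\<tau> (Suc n)) \<circ> \<tau>"
  have "?\<tau>' permutes {1..?m}"
    using \<tau> permutes_in_image[OF \<tau>, of ?m] by (intro permutes_compose permutes_swap_id) auto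
  then show "?\<tau>' permutes {1..n}"
    by (rule permutes_superset) (auto simp: le_Suc_eq)
  fix T assume T: "T \<in> new_in_first_row ?m" and \<tau>T: "act_tabloid \<tau> T \<in> new_in_first_row ?m"
  have inj: "inj \<tau>" using \<tau> by (rule permutes_inj)
  have swap: "?\<tau>' ` T i = \<tau> ` T i" for i
  proof -
    have "\<tau> ?m \<in> \<tau> ` T i \<longleftrightarrow> i = 0"
      using T inj by (auto simp: new_in_first_row_def inj_image_mem_iff)
    moreover have "?m \<in> \<tau> ` T i \<longleftrightarrow> i = 0"
      using \<tau>T by (auto simp: new_in_first_row_def act_tabloid_def)
    ultimately have "transpose ?m (\<tau> ?m) ` \<tau> ` T i = \<tau> ` T i"
      by (intro transpose_image_eq) blast
    then show ?thesis by (simp add: image_comp)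
  qed
  have "inj ?\<tau>'" using inj by (intro inj_compose) auto
  then have "?\<tau>' ` (T i - {?m}) = ?\<tau>' ` T i - ?\<tau>' ` {?m}" for i
    by (rule image_set_diff)
  moreover have fixed: "?\<tau>' ?m = ?m" by simp
  ultimately show "delete_entry ?m (act_tabloid \<tau> T) = act_tabloid ?\<tau>' (delete_entry ?m T)"
    unfolding delete_entry_def act_tabloid_def by (simp only: swap fixed image_insert image_empty)
qed

abbreviation adjoin :: "nat \<Rightarrow> ((nat \<Rightarrow> nat set) \<Rightarrow> rat) \<Rightarrow> (nat \<Rightarrow> nat set) \<Rightarrow> rat" where
  "adjoin m \<equiv> extend_by_zero (new_in_first_row m) (delete_entry m)"

lemma extend_by_zero_span:
  assumes "v \<in> fun_space.span S" and "fun_space.subspace V'"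
    and "\<And>b. b \<in> S \<Longrightarrow> extend_by_zero J r b \<in> V'"
  shows "extend_by_zero J r v \<in> V'"
  using assms(1)
proof (induction rule: fun_space.span_induct_alt)
  case base
  have "extend_by_zero J r 0 = 0" by (auto simp: extend_by_zero_def)
  then show ?case using fun_space.subspace_0[OF assms(2)] by (simp only:)
next
  case (step c b v)
  have "extend_by_zero J r (scale_fun c b + v) =
      scale_fun c (extend_by_zero J r b) + extend_by_zero J r v"
    by (auto simp: extend_by_zero_def scale_fun_def)
  also have "\<dots> \<in> V'"
    using step assms(2,3) by (intro fun_space.subspace_add fun_space.subspace_scale)
  finally show ?case .
qed

lemma extend_by_zero_tensor:
  assumes "\<And>v. v \<in> V \<Longrightarrow> extend_by_zero J r v \<in> V'"
    and "\<And>w. w \<in> W \<Longrightarrow> extend_by_zero L s w \<in> W'"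
    and "u \<in> tensor V W"
  shows "extend_by_zero (J \<times> L) (map_prod r s) u \<in> tensor V' W'"
  using assms(3) unfolding tensor_def[of V W]
proof (rule extend_by_zero_span[OF _ subspace_tensor])
  fix b assume "b \<in> {pure_tensor v w | v w. v \<in> V \<and> w \<in> W}"
  then obtain v w where b: "b = pure_tensor v w" "v \<in> V" "w \<in> W" by blast
  have "extend_by_zero (J \<times> L) (map_prod r s) b =
      pure_tensor (extend_by_zero J r v) (extend_by_zero L s w)"
    by (auto simp: b extend_by_zero_def pure_tensor_def)
  then show "extend_by_zero (J \<times> L) (map_prod r s) b \<in> tensor V' W'"
    using pure_tensor_in_tensor[OF assms(1)[OF b(2)] assms(2)[OF b(3)]] by simp
qed

text \<open>As the rows weakly decrease, no other box lies in the column of the new box \<open>(0, a 0)\<close>. Every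
  element of the column stabilizer of the larger tableau therefore fixes the new entry.\<close>

lemma adjoin_polytabloid:
  assumes a: "antimono a" and t: "is_tableau n a t"
  defines "a' \<equiv> a(0 := Suc (a 0))" and "t' \<equiv> t((0, a 0) := Suc n)"
  shows "is_tableau (Suc n) a' t'"
    and "adjoin (Suc n) (polytabloid n a t) = polytabloid (Suc n) a' t'"
proof -
  have diag: "diagram a' = insert (0, a 0) (diagram a)" "(0, a 0) \<notin> diagram a"
    by (auto simp: diagram_def a'_def split: if_splits)
  have bij: "bij_betw t (diagram a) {1..n}" using t by (simp add: is_tableau_def)
  have "bij_betw t' (diagram a) {1..n}"
    using bij diag(2) by (subst bij_betw_cong[of _ t' t]) (auto simp: t'_def)
  moreover have "t' (0, a 0) = Suc n" by (simp add: t'_def)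
  ultimately have "bij_betw t' (insert (0, a 0) (diagram a)) (insert (Suc n) {1..n})"
    using diag(2) notIn_Un_bij_betw[of "(0, a 0)" "diagram a" t' "{1..n}"] by auto
  then show "is_tableau (Suc n) a' t'"
    by (simp add: is_tableau_def diag(1) atLeastAtMostSuc_conv)
  have t'_diag: "t' p = t p" if "p \<in> diagram a" for p
    using that diag(2) by (auto simp: t'_def)
  have col: "column a' t' j = (if j = a 0 then {Suc n} else column a t j)" for j
  proof (cases "j = a 0")
    case True
    have "(i, a 0) \<notin> diagram a" for i
      using antimonoD[OF a, of 0 i] by (auto simp: diagram_def)
    then show ?thesis using True by (auto simp: column_def diag(1) t'_def)
  next
    case False
    then show ?thesis using t'_diag by (force simp: column_def diag(1))
  qed
  have col0: "column a t (a 0) = {}"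
    using antimonoD[OF a, of 0] by (force simp: column_def diagram_def not_less)
  have stab: "column_stabilizer (Suc n) a' t' = column_stabilizer n a t"
  proof (intro equalityI subsetI)
    fix \<sigma> assume \<sigma>: "\<sigma> \<in> column_stabilizer (Suc n) a' t'"
    then have "\<sigma> ` column a' t' (a 0) = column a' t' (a 0)" and p: "\<sigma> permutes {1..Suc n}"
      by (auto simp: column_stabilizer_def)
    then have "\<sigma> (Suc n) = Suc n" by (simp add: col)
    then have "\<sigma> permutes {1..n}"
      using p by (intro permutes_superset[OF p]) (auto simp: le_Suc_eq)
    moreover have "\<sigma> ` column a t j = column a t j" for j
    proof (cases "j = a 0")
      case False
      have "\<sigma> ` column a' t' j = column a' t' j" using \<sigma> by (simp add: column_stabilizer_def)
      then show ?thesis using False by (simp add: col)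
    qed (simp add: col0)
    ultimately show "\<sigma> \<in> column_stabilizer n a t" by (simp add: column_stabilizer_def)
  next
    fix \<sigma> assume \<sigma>: "\<sigma> \<in> column_stabilizer n a t"
    then have p: "\<sigma> permutes {1..n}" by (simp add: column_stabilizer_def)
    then have "\<sigma> permutes {1..Suc n}" by (rule permutes_subset) auto
    moreover have "\<sigma> (Suc n) = Suc n" using p by (rule permutes_not_in) auto
    ultimately show "\<sigma> \<in> column_stabilizer (Suc n) a' t'"
      using \<sigma> by (simp add: column_stabilizer_def col)
  qed
  have tab: "tabloid a' t' = (tabloid a t)(0 := insert (Suc n) (tabloid a t 0))"
  proof
    fix i
    show "tabloid a' t' i = ((tabloid a t)(0 := insert (Suc n) (tabloid a t 0))) i"
      using t'_diag by (force simp: tabloid_def diag t'_def)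
  qed
  show "adjoin (Suc n) (polytabloid n a t) = polytabloid (Suc n) a' t'"
  proof
    fix T
    have "of_bool (T = act_tabloid \<sigma> (tabloid a' t')) =
        (if T \<in> new_in_first_row (Suc n)
         then of_bool (delete_entry (Suc n) T = act_tabloid \<sigma> (tabloid a t)) else 0 :: rat)"
      if "\<sigma> \<in> column_stabilizer n a t" for \<sigma>
    proof -
      have p: "\<sigma> permutes {1..n}" using that by (simp add: column_stabilizer_def)
      define U where "U = act_tabloid \<sigma> (tabloid a t)"
      have "U \<in> row_sets n a"
        unfolding U_def by (intro act_tabloid_row_sets p tabloid_row_sets t)
      then have U: "Suc n \<notin> U i" for i by (force simp: row_sets_def)
      have "\<sigma> (Suc n) = Suc n" using p by (rule permutes_not_in) auto
      then have "act_tabloid \<sigma> (tabloid a' t') = U(0 := insert (Suc n) (U 0))"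
        by (auto simp: tab act_tabloid_def U_def fun_eq_iff)
      moreover have "T = U(0 := insert (Suc n) (U 0)) \<longleftrightarrow>
          T \<in> new_in_first_row (Suc n) \<and> delete_entry (Suc n) T = U"
      proof
        assume "T = U(0 := insert (Suc n) (U 0))"
        then show "T \<in> new_in_first_row (Suc n) \<and> delete_entry (Suc n) T = U"
          using U by (auto simp: new_in_first_row_def delete_entry_def fun_eq_iff)
      next
        assume "T \<in> new_in_first_row (Suc n) \<and> delete_entry (Suc n) T = U"
        then show "T = U(0 := insert (Suc n) (U 0))"
          by (auto simp: new_in_first_row_def delete_entry_def fun_eq_iff)
      qed
      ultimately show ?thesis by (simp add: U_def)
    qed
    then show "adjoin (Suc n) (polytabloid n a t) T = polytabloid (Suc n) a' t' T"
      by (auto simp: extend_by_zero_def polytabloid_def stab intro!: sum.cong)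
  qed
qed

lemma adjoin_specht:
  assumes "antimono a" and "v \<in> specht n a"
  shows "adjoin (Suc n) v \<in> specht (Suc n) (a(0 := Suc (a 0)))"
  using assms(2) unfolding specht_def[of n a]
proof (rule extend_by_zero_span[OF _ subspace_specht])
  fix b assume "b \<in> {polytabloid n a t | t. is_tableau n a t}"
  then show "adjoin (Suc n) b \<in> specht (Suc n) (a(0 := Suc (a 0)))"
    using adjoin_polytabloid[OF assms(1)]
    by (auto simp: specht_def intro!: fun_space.span_base)
qed

section \<open>Monotonicity of Kronecker coefficients\<close>

lemma kronecker_le_kronecker_longer_first_rows:
  assumes "is_partition a" "is_partition b" "is_partition c"
  shows "kronecker n a b c \<le>
    kronecker (Suc n) (a(0 := Suc (a 0))) (b(0 := Suc (b 0))) (c(0 := Suc (c 0)))"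
proof -
  let ?up = "\<lambda>a::nat \<Rightarrow> nat. a(0 := Suc (a 0))" and ?ac2 = "\<lambda>\<sigma>. map_prod (act_tabloid \<sigma>) (act_tabloid \<sigma>)"
  let ?J = "new_in_first_row (Suc n)" and ?r = "delete_entry (Suc n)"
  have fin: "finite {i. d i \<noteq> 0}" "finite {i. ?up d i \<noteq> 0}" and anti: "antimono d"
    if "d \<in> {a, b, c}" for d
  proof -
    show fin: "finite {i. d i \<noteq> 0}" and "antimono d"
      using assms that by (auto simp: is_partition_def)
    show "finite {i. ?up d i \<noteq> 0}"
      by (rule finite_subset[of _ "insert 0 {i. d i \<noteq> 0}"]) (use fin in auto)
  qed
  have pair: "permutation_rep_pair {1..m} ?ac2 (row_sets m a \<times> row_sets m b)
      (tensor (specht m a) (specht m b)) act_tabloid (row_sets m c) (specht m c)"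
    if "finite {i. a i \<noteq> 0}" "finite {i. b i \<noteq> 0}" "finite {i. c i \<noteq> 0}" for m a b c
    unfolding permutation_rep_pair_def
    using that by (intro conjI permutation_rep_tensor permutation_rep_specht)
  have kron: "kronecker m a b c = map_space.dim (permutation_rep_pair.Hom {1..m} ?ac2
      (tensor (specht m a) (specht m b)) act_tabloid (specht m c))"
    if "finite {i. a i \<noteq> 0}" "finite {i. b i \<noteq> 0}" "finite {i. c i \<noteq> 0}" for m a b c
  proof -
    interpret permutation_rep_pair "{1..m}" ?ac2 "row_sets m a \<times> row_sets m b"
        "tensor (specht m a) (specht m b)" act_tabloid "row_sets m c" "specht m c"
      using that by (rule pair)
    have "dom.rep = diag_act" "cod.rep = act"
      by (auto simp: fun_eq_iff dom.rep_def cod.rep_def diag_act_def act_def)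
    then show ?thesis by (simp add: kronecker_def)
  qed
  have "map_space.dim (permutation_rep_pair.Hom {1..n} ?ac2
      (tensor (specht n a) (specht n b)) act_tabloid (specht n c)) \<le>
    map_space.dim (permutation_rep_pair.Hom {1..Suc n} ?ac2
      (tensor (specht (Suc n) (?up a)) (specht (Suc n) (?up b))) act_tabloid
      (specht (Suc n) (?up c)))"
  proof (rule dim_Hom_le[where J = "?J \<times> ?J" and r = "map_prod ?r ?r" and L = ?J and s = ?r,
        OF pair pair])
    show "extend_by_zero (?J \<times> ?J) (map_prod ?r ?r) u \<in>
        tensor (specht (Suc n) (?up a)) (specht (Suc n) (?up b))"
      if "u \<in> tensor (specht n a) (specht n b)" for u
      using _ _ that by (rule extend_by_zero_tensor) (auto intro: adjoin_specht anti)
    show "adjoin (Suc n) w \<in> specht (Suc n) (?up c)" if "w \<in> specht n c" for w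
      using that by (intro adjoin_specht anti) auto
    show "row_sets n a \<times> row_sets n b \<subseteq> map_prod ?r ?r ` (?J \<times> ?J)"
      using row_sets_subset_delete_entry[of n a] row_sets_subset_delete_entry[of n b]
      by (simp only: map_prod_surj_on[OF refl refl] Sigma_mono)
    show "row_sets n c \<subseteq> ?r ` ?J" by (rule row_sets_subset_delete_entry)
    fix \<tau> assume "\<tau> permutes {1..Suc n}"
    from delete_entry_act[OF this] show "\<exists>\<tau>'. \<tau>' permutes {1..n} \<and>
        (\<forall>x\<in>?J \<times> ?J. ?ac2 \<tau> x \<in> ?J \<times> ?J \<longrightarrow>
          map_prod ?r ?r (?ac2 \<tau> x) = ?ac2 \<tau>' (map_prod ?r ?r x)) \<and>
        (\<forall>z\<in>?J. act_tabloid \<tau> z \<in> ?J \<longrightarrow> ?r (act_tabloid \<tau> z) = act_tabloid \<tau>' (?r z))"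
      by fastforce
  qed (use fin in auto)
  then show ?thesis using fin by (simp only: kron insertI1 insertI2 simp_thms)
qed

text \<open>The partition hypothesis ensures \<open>psize \<alpha> \<le> n\<close>, so that the subtraction in the first entry is
  not truncated.\<close>

lemma padded_Suc:
  assumes "is_partition \<alpha>" "partition_of n (padded n \<alpha>)"
  shows "padded (n + 1) \<alpha> = (padded n \<alpha>)(0 := Suc (padded n \<alpha> 0))"
  using assms partition_of_padded_iff[of \<alpha> n]
  by (auto simp: padded_def fun_eq_iff Suc_diff_le split: nat.split)

theorem corollary7p7:
  fixes n :: nat and \<alpha> \<beta> \<gamma> :: "nat \<Rightarrow> nat"
  assumes "is_partition \<alpha>" and "is_partition \<beta>" and "is_partition \<gamma>"
    and "partition_of n (padded n \<alpha>)"
    and "partition_of n (padded n \<beta>)"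
    and "partition_of n (padded n \<gamma>)"
  shows "kronecker n (padded n \<alpha>) (padded n \<beta>) (padded n \<gamma>)
    \<le> kronecker (n + 1) (padded (n + 1) \<alpha>) (padded (n + 1) \<beta>) (padded (n + 1) \<gamma>)"
proof -
  have "is_partition (padded n \<alpha>)" "is_partition (padded n \<beta>)" "is_partition (padded n \<gamma>)"
    using assms by (simp_all add: partition_of_def)
  then show ?thesis
    using kronecker_le_kronecker_longer_first_rows[of "padded n \<alpha>" "padded n \<beta>" "padded n \<gamma>" n]
    by (simp only: padded_Suc[OF assms(1,4)] padded_Suc[OF assms(2,5)] padded_Suc[OF assms(3,6)]
        Suc_eq_plus1)
qed

end
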